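(* (1) There is no connected involutory quandle of size $2^k$, for any $k\ge1$. (2) There is no connected involutory rack of size $2^k$, for any $k>1$.
   Context: A left quasigroup is a nonempty set $Q$ with two binary operations $*,\backslash$ satisfying $x\backslash(x*y)=y=x*(x\backslash y)$; write $L_a(b)=a*b$, a permutation of $Q$. A rack is a left quasigroup satisfying $x*(y*z)=(x*y)*(x*z)$; a quandle is a rack satisfying $x*x=x$. $Q$ is involutory if $x*(x*y)=y$ for all $x,y$ (equivalently $L_a^2=1$ for all $a$). $Q$ is connected if the group $\langle L_a: a\in Q\rangle$ acts transitively on $Q$. *)

theory Defs
  imports "HOL-Algebra.Algebra"
begin

locale left_quasigroup =
  fixes Q :: "'a set"
    and mul :: "'a \<Rightarrow> 'a \<Rightarrow> 'a"  (infixl "\<star>" 70)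
    and ldiv :: "'a \<Rightarrow> 'a \<Rightarrow> 'a"  (infixl "\<rightharpoondown>" 70)
  assumes nonempty: "Q \<noteq> {}"
    and mul_closed: "\<lbrakk>x \<in> Q; y \<in> Q\<rbrakk> \<Longrightarrow> x \<star> y \<in> Q"
    and ldiv_closed: "\<lbrakk>x \<in> Q; y \<in> Q\<rbrakk> \<Longrightarrow> x \<rightharpoondown> y \<in> Q"
    and ldiv_mul: "\<lbrakk>x \<in> Q; y \<in> Q\<rbrakk> \<Longrightarrow> x \<rightharpoondown> (x \<star> y) = y"
    and mul_ldiv: "\<lbrakk>x \<in> Q; y \<in> Q\<rbrakk> \<Longrightarrow> x \<star> (x \<rightharpoondown> y) = y"

locale rack = left_quasigroup +
  assumes left_distrib: "\<lbrakk>x \<in> Q; y \<in> Q; z \<in> Q\<rbrakk> \<Longrightarrow> x \<star> (y \<star> z) = (x \<star> y) \<star> (x \<star> z)"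

locale quandle = rack +
  assumes idem: "x \<in> Q \<Longrightarrow> x \<star> x = x"

definition involutory :: "'a set \<Rightarrow> ('a \<Rightarrow> 'a \<Rightarrow> 'a) \<Rightarrow> bool" where
  "involutory Q mul \<longleftrightarrow> (\<forall>x\<in>Q. \<forall>y\<in>Q. mul x (mul x y) = y)"

text \<open>Translations are restricted to \<open>Q\<close> because the elements of the symmetric group
  \<^term>\<open>BijGroup Q\<close> are the bijections of \<open>Q\<close> that are \<^const>\<open>undefined\<close> outside of \<open>Q\<close>.\<close>

definition left_translation :: "'a set \<Rightarrow> ('a \<Rightarrow> 'a \<Rightarrow> 'a) \<Rightarrow> 'a \<Rightarrow> 'a \<Rightarrow> 'a" where
  "left_translation Q mul a = (\<lambda>b\<in>Q. mul a b)"

definition left_mult_group :: "'a set \<Rightarrow> ('a \<Rightarrow> 'a \<Rightarrow> 'a) \<Rightarrow> ('a \<Rightarrow> 'a) monoid" where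
  "left_mult_group Q mul =
     BijGroup Q \<lparr>carrier := generate (BijGroup Q) (left_translation Q mul ` Q)\<rparr>"

definition connected_lq :: "'a set \<Rightarrow> ('a \<Rightarrow> 'a \<Rightarrow> 'a) \<Rightarrow> bool" where
  "connected_lq Q mul \<longleftrightarrow> transitive_action (left_mult_group Q mul) Q (\<lambda>g. g)"

text \<open>The inclusion of the left multiplication group into \<^term>\<open>BijGroup Q\<close> is always an action,
  so connectedness amounts to transitivity alone.\<close>

context left_quasigroup
begin

lemma left_translation_Bij:
  assumes a: "a \<in> Q"
  shows "left_translation Q mul a \<in> carrier (BijGroup Q)"
proof -
  have "bij_betw (left_translation Q mul a) Q Q"
    by (rule bij_betw_byWitness[where f' = "ldiv a"])
       (use a in \<open>auto simp: left_translation_def ldiv_mul mul_ldiv mul_closed ldiv_closed\<close>)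
  then show ?thesis
    by (simp add: BijGroup_def Bij_def left_translation_def)
qed

lemma group_action_left_mult_group: "group_action (left_mult_group Q mul) Q (\<lambda>g. g)"
proof -
  have "subgroup (generate (BijGroup Q) (left_translation Q mul ` Q)) (BijGroup Q)"
    by (rule group.generate_is_subgroup[OF group_BijGroup]) (use left_translation_Bij in auto)
  then have "group_hom (left_mult_group Q mul) (BijGroup Q) (\<lambda>g. g)"
    unfolding left_mult_group_def
    by (metis group.canonical_inj_is_hom group_BijGroup id_def eq_id_iff)
  then show ?thesis
    by (rule group_action.intro)
qed

lemma connected_lq_iff:
  "connected_lq Q mul \<longleftrightarrow>
     (\<forall>x\<in>Q. \<forall>y\<in>Q. \<exists>g\<in>generate (BijGroup Q) (left_translation Q mul ` Q). g x = y)"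
  using group_action_left_mult_group
  by (auto simp: connected_lq_def transitive_action_def transitive_action_axioms_def
        left_mult_group_def)

end

end

theory Submission
  imports Defs
begin

text \<open>A rack structure makes \<open>x \<mapsto> L\<^sub>x\<close> equivariant: \<open>L\<^bsub>g x\<^esub> = g L\<^sub>x g\<inverse>\<close> for every
  \<open>g\<close> in the left multiplication group \<open>G\<close>. In a connected rack \<open>Q\<close> the translations
  therefore form a single conjugacy class, and they generate \<open>G\<close>. When \<open>|Q|\<close> is a power of
  a prime \<open>p\<close> and the translations have \<open>p\<close>-power order, this forces \<open>G\<close> to be cyclic, in two
  steps (\<open>prime_power_degree_equivariant_imp_cyclic\<close>).

  The first step shows that \<open>G\<close> is a \<open>p\<close>-group. Let \<open>S\<close> be a Sylow \<open>p\<close>-subgroup. The \<open>p\<close>-group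
  generated by \<open>L\<^sub>x\<close> acts on the cosets of \<open>S\<close>, whose number is prime to \<open>p\<close>, so it fixes one of
  them; this means that \<open>S\<close> contains a conjugate of \<open>L\<^sub>x\<close>, which is again some \<open>L\<^sub>y\<close>. As \<open>|Q|\<close> is
  a power of \<open>p\<close>, already \<open>S\<close> is transitive on \<open>Q\<close>, so every \<open>L\<^sub>z\<close> is conjugate to \<open>L\<^sub>y\<close> by an
  element of \<open>S\<close>. Hence \<open>S\<close> contains all translations, and \<open>S = G\<close>.

  The second step is that a \<open>p\<close>-group generated by the conjugacy class of an element is generated
  by that element: otherwise the cyclic subgroup lies in a proper normal subgroup,
  which then contains the whole class.

  For an involutory rack and \<open>p = 2\<close> this gives \<open>G = {1, L\<^sub>x}\<close>, and transitivity leaves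
  \<open>Q = {x, x \<star> x}\<close>. So \<open>|Q| \<le> 2\<close>, and \<open>|Q| = 1\<close> if \<open>x \<star> x = x\<close>.\<close>

section \<open>Actions of p-groups\<close>

text \<open>The points that are not fixed split into orbits, whose sizes are powers of \<open>p\<close> other than \<open>1\<close>.\<close>

lemma (in group_action) p_group_card_fixed_points:
  assumes p: "Factorial_Ring.prime (p::nat)" and G: "order G = p ^ n" and E: "finite E"
  shows "p dvd card E - card {x \<in> E. \<forall>g\<in>carrier G. \<phi> g x = x}"
proof -
  interpret G: group G
    using group_hom group_hom.axioms(1) by auto
  let ?F = "{x \<in> E. \<forall>g\<in>carrier G. \<phi> g x = x}"
  \<comment> \<open>The indicator function of the moved points turns the orbit decomposition into a sum.\<close>
  let ?f = "\<lambda>x. if x \<in> ?F then 0 else 1 :: nat"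
  have "p dvd (\<Sum>x\<in>orb. ?f x)" if O: "orb \<in> orbits G E \<phi>" for orb
  proof -
    obtain x where x: "x \<in> E" and orb: "orb = orbit G \<phi> x"
      using O by (auto simp: orbits_def)
    show ?thesis
    proof (cases "card orb = 1")
      case True
      then obtain y where y: "orb = {y}"
        using card_1_singletonE by blast
      then have "y = x"
        using orbit_refl[OF x] orb by auto
      then have "x \<in> ?F"
        using x y orb by (auto simp: orbit_def)
      then show ?thesis
        using y \<open>y = x\<close> by simp
    next
      case False
      have "card orb dvd p ^ n"
        using orbit_stabilizer_theorem[OF x] G orb by (metis dvd_triv_left)
      then have "p dvd card orb"
        using False p by (auto simp: divides_primepow_nat)
      moreover have "?f y = 1" if y: "y \<in> orb" for y
      proof -
        have yE: "y \<in> E"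
          using y orb x by (auto simp: orbit_def element_image)
        have "y \<notin> ?F"
        proof
          assume "y \<in> ?F"
          then have "orbit G \<phi> y \<subseteq> {y}"
            by (auto simp: orbit_def)
          moreover have "orb \<subseteq> orbit G \<phi> y"
          proof
            fix z assume z: "z \<in> orb"
            then have "z \<in> E"
              using orb x by (auto simp: orbit_def element_image)
            then show "z \<in> orbit G \<phi> y"
              using orbit_trans[OF yE x _ orbit_sym[OF x yE]] y z orb by blast
          qed
          ultimately have "orb = {y}"
            using y by auto
          with False show False
            by simp
        qed
        then show ?thesis
          by simp
      qed
      ultimately show ?thesis
        by simp
    qed
  qed
  then have "p dvd (\<Sum>orb\<in>orbits G E \<phi>. \<Sum>x\<in>orb. ?f x)"
    by (rule dvd_sum)
  also have "\<dots> = (\<Sum>x\<in>E. ?f x)"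
    by (rule disjoint_sum[OF E])
  also have "\<dots> = (\<Sum>x\<in>E - ?F. 1)"
    using E by (intro sum.mono_neutral_cong_right) auto
  also have "\<dots> = card (E - ?F)"
    by simp
  also have "\<dots> = card E - card ?F"
    using E by (intro card_Diff_subset) auto
  finally show ?thesis .
qed

text \<open>Multiplying right cosets on the right by \<open>inv g\<close>, not by \<open>g\<close>, gives a left action.\<close>

lemma (in group) right_multiplication_action:
  assumes H: "subgroup H G"
  shows "group_action G (rcosets H) (\<lambda>g. \<lambda>C\<in>rcosets H. C #> inv g)"
proof -
  have sub: "C \<subseteq> carrier G" if "C \<in> rcosets H" for C
    using that rcosets_subset_PowG[OF H] by blast
  have closed: "C #> g \<in> rcosets H" if "C \<in> rcosets H" "g \<in> carrier G" for C g
    using that subgroup.subset[OF H]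
    by (auto simp: RCOSETS_def coset_mult_assoc)
  have assoc: "(C #> g) #> h = C #> (g \<otimes> h)" if "C \<in> rcosets H" "g \<in> carrier G" "h \<in> carrier G" for C g h
    using coset_mult_assoc sub that by blast
  have one: "C #> \<one> = C" if "C \<in> rcosets H" for C
    using sub that by (simp add: coset_mult_one)
  have bij: "(\<lambda>C\<in>rcosets H. C #> inv g) \<in> Bij (rcosets H)" if "g \<in> carrier G" for g
  proof -
    have "bij_betw (\<lambda>C\<in>rcosets H. C #> inv g) (rcosets H) (rcosets H)"
      by (rule bij_betw_byWitness[where f' = "\<lambda>C. C #> g"])
         (use that in \<open>auto simp: closed assoc one\<close>)
    then show ?thesis
      by (simp add: Bij_def)
  qed
  have "(\<lambda>g. \<lambda>C\<in>rcosets H. C #> inv g) \<in> hom G (BijGroup (rcosets H))"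
    by (rule homI)
       (auto simp: BijGroup_def bij compose_def closed assoc inv_mult_group intro!: restrict_ext)
  then show ?thesis
    by (intro group_action.intro group_hom.intro group_hom_axioms.intro is_group group_BijGroup)
qed

text \<open>Fixed points of \<open>P\<close> on the cosets of \<open>H\<close> are the way to find elements that conjugate \<open>P\<close>
  into \<open>H\<close>: with \<open>P\<close> a \<open>p\<close>-group and \<open>H\<close> a Sylow subgroup this gives the containment part of
  Sylow's theorem, and with \<open>P = H\<close> it gives elements that normalise \<open>H\<close>.\<close>

lemma (in group) fixed_coset_iff:
  assumes H: "subgroup H G" and P: "P \<subseteq> carrier G" and g: "g \<in> carrier G"
  shows "(\<forall>h\<in>P. (H #> g) #> h = H #> g) \<longleftrightarrow> (\<forall>h\<in>P. g \<otimes> h \<otimes> inv g \<in> H)"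
proof (rule ball_cong[OF refl])
  fix h assume "h \<in> P"
  then have h: "h \<in> carrier G"
    using P by blast
  have HG: "H \<subseteq> carrier G"
    by (rule subgroup.subset[OF H])
  have "(H #> g) #> h = H #> g \<longleftrightarrow> H #> (g \<otimes> h) = H #> g"
    using HG g h by (simp add: coset_mult_assoc)
  also have "\<dots> \<longleftrightarrow> H #> (g \<otimes> h \<otimes> inv g) = H"
    using coset_mult_inv1[OF _ m_closed[OF g h] g HG] coset_mult_inv2[OF _ m_closed[OF g h] g HG]
    by blast
  also have "\<dots> \<longleftrightarrow> g \<otimes> h \<otimes> inv g \<in> H"
    using coset_join1[OF _ _ H] coset_join2[OF _ H] g h by (metis inv_closed m_closed)
  finally show "(H #> g) #> h = H #> g \<longleftrightarrow> g \<otimes> h \<otimes> inv g \<in> H" .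
qed

lemma (in group) p_subgroup_card_fixed_cosets:
  assumes p: "Factorial_Ring.prime (p::nat)" and fin: "finite (carrier G)"
    and H: "subgroup H G" and P: "subgroup P G" "card P = p ^ n"
  shows "p dvd card (rcosets H) - card {C \<in> rcosets H. \<forall>h\<in>P. C #> h = C}"
proof -
  let ?\<phi> = "\<lambda>g. \<lambda>C\<in>rcosets H. C #> inv g"
  interpret A: group_action "G\<lparr>carrier := P\<rparr>" "rcosets H" ?\<phi>
    by (rule group_action.induced_action[OF right_multiplication_action[OF H] P(1)])
  have "finite (rcosets H)"
    using finite_subset[OF rcosets_subset_PowG[OF H]] fin by simp
  then have "p dvd card (rcosets H)
      - card {C \<in> rcosets H. \<forall>g\<in>carrier (G\<lparr>carrier := P\<rparr>). ?\<phi> g C = C}"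
    by (rule A.p_group_card_fixed_points[OF p, rotated]) (simp add: order_def P(2))
  also have "{C \<in> rcosets H. \<forall>g\<in>carrier (G\<lparr>carrier := P\<rparr>). ?\<phi> g C = C}
      = {C \<in> rcosets H. \<forall>h\<in>P. C #> h = C}"
  proof -
    have "(\<forall>g\<in>P. C #> inv g = C) \<longleftrightarrow> (\<forall>h\<in>P. C #> h = C)" for C
      using subgroup.m_inv_closed[OF P(1)] subgroup.mem_carrier[OF P(1)] by (metis inv_inv)
    then show ?thesis
      by auto
  qed
  finally show ?thesis .
qed

lemma (in group) subgroup_conjugation_invariant:
  assumes M: "subgroup M G"
  shows "subgroup {g \<in> carrier G. (\<lambda>h. g \<otimes> h \<otimes> inv g) ` M = M} G" (is "subgroup ?N G")
proof -
  have MG: "h \<in> carrier G" if "h \<in> M" for h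
    using subgroup.mem_carrier[OF M that] .
  show ?thesis
  proof (rule subgroupI)
    show "?N \<subseteq> carrier G"
      by blast
    have "(\<lambda>h. \<one> \<otimes> h \<otimes> inv \<one>) ` M = M"
      using MG by force
    then show "?N \<noteq> {}"
      by blast
  next
    fix a assume a: "a \<in> ?N"
    have "(\<lambda>h. inv a \<otimes> h \<otimes> inv (inv a)) ` M
        = (\<lambda>h. inv a \<otimes> h \<otimes> inv (inv a)) ` (\<lambda>h. a \<otimes> h \<otimes> inv a) ` M"
      using a by simp
    also have "\<dots> = (\<lambda>h. h) ` M"
      unfolding image_image
      by (rule image_cong) (use a MG in \<open>auto simp: m_assoc simp flip: m_assoc[of "inv a" a]\<close>)
    finally show "inv a \<in> ?N"
      using a by simp
  next
    fix a b assume a: "a \<in> ?N" and b: "b \<in> ?N"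
    have "(\<lambda>h. (a \<otimes> b) \<otimes> h \<otimes> inv (a \<otimes> b)) ` M
        = (\<lambda>h. a \<otimes> h \<otimes> inv a) ` (\<lambda>h. b \<otimes> h \<otimes> inv b) ` M"
      unfolding image_image
      by (rule image_cong) (use a b MG in \<open>auto simp: m_assoc inv_mult_group\<close>)
    also have "\<dots> = M"
      using a b by simp
    finally show "a \<otimes> b \<in> ?N"
      using a b by simp
  qed
qed

text \<open>Let \<open>M\<close> act on its own cosets. Their number is divisible by \<open>p\<close>, hence so is the number of
  fixed ones. The coset \<open>M\<close> itself is fixed, so there is another fixed coset, and its
  representative normalises \<open>M\<close> without lying in \<open>M\<close>. By maximality the normaliser of \<open>M\<close> is
  the whole group.\<close>

lemma (in group) p_group_maximal_subgroup_normal: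
  assumes p: "Factorial_Ring.prime (p::nat)" and G: "order G = p ^ n"
    and M: "subgroup M G" "M \<noteq> carrier G"
    and max: "\<And>K. subgroup K G \<Longrightarrow> M \<subseteq> K \<Longrightarrow> K = M \<or> K = carrier G"
  shows "M \<lhd> G"
proof -
  let ?F = "{C \<in> rcosets M. \<forall>h\<in>M. C #> h = C}"
  let ?N = "{g \<in> carrier G. (\<lambda>h. g \<otimes> h \<otimes> inv g) ` M = M}"
  have "order G > 0"
    using G p prime_gt_0_nat by simp
  then have fin: "finite (carrier G)"
    by (simp add: order_gt_0_iff_finite)
  have MG: "M \<subseteq> carrier G"
    by (rule subgroup.subset[OF M(1)])
  have finM: "finite M"
    using fin MG finite_subset by blast
  have lag: "card (rcosets M) * card M = p ^ n"
    using lagrange[OF M(1)] G by simp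
  have "card M dvd p ^ n"
    using lag by (metis dvd_triv_right)
  then obtain m where m: "card M = p ^ m"
    using p by (auto simp: divides_primepow_nat)
  have "card (rcosets M) \<noteq> 1"
    using lag M(2) G MG fin card_subset_eq[OF fin MG] by (auto simp: order_def)
  moreover have "card (rcosets M) dvd p ^ n"
    using lag by (metis dvd_triv_left)
  ultimately have index: "p dvd card (rcosets M)"
    using p by (auto simp: divides_primepow_nat)
  have finC: "finite (rcosets M)"
    using finite_subset[OF rcosets_subset_PowG[OF M(1)]] fin by simp
  then have "card ?F \<le> card (rcosets M)"
    by (intro card_mono) auto
  then have "p dvd card ?F"
    by (rule dvd_diffD1[OF p_subgroup_card_fixed_cosets[OF p fin M(1) M(1) m] index])
  moreover have "M \<in> ?F"
    using coset_join2 M(1) MG subgroup.subgroup_in_rcosets[OF M(1) is_group] by auto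
  then have "card ?F > 0"
    using finC by (auto simp: card_gt_0_iff)
  ultimately have "card ?F \<ge> p"
    by (simp add: dvd_imp_le)
  then have "\<not> ?F \<subseteq> {M}"
    using prime_ge_2_nat[OF p] card_mono[of "{M}" ?F] by auto
  then obtain g where g: "g \<in> carrier G" "M #> g \<noteq> M" "\<forall>h\<in>M. (M #> g) #> h = M #> g"
    by (auto simp: RCOSETS_def)
  have "g \<notin> M"
    using g M(1) coset_join2 by blast
  \<comment> \<open>A fixed coset only gives an inclusion; finiteness of \<open>M\<close> makes it an equality.\<close>
  have "(\<lambda>h. g \<otimes> h \<otimes> inv g) ` M \<subseteq> M"
    using fixed_coset_iff[OF M(1) MG g(1)] g(3) by blast
  moreover have "inj_on (\<lambda>h. g \<otimes> h \<otimes> inv g) M"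
    using g(1) MG by (auto intro!: inj_onI simp: subset_iff)
  ultimately have "g \<in> ?N"
    using g(1) finM by (simp add: endo_inj_surj)
  moreover have "M \<subseteq> ?N"
  proof
    fix k assume k: "k \<in> M"
    then have kG: "k \<in> carrier G"
      using MG by blast
    have "(\<lambda>h. k \<otimes> h \<otimes> inv k) ` M \<subseteq> M"
      using k M(1) by (auto simp: subgroup.m_closed subgroup.m_inv_closed)
    moreover have "inj_on (\<lambda>h. k \<otimes> h \<otimes> inv k) M"
      using kG MG by (auto intro!: inj_onI simp: subset_iff)
    ultimately show "k \<in> ?N"
      using kG finM by (simp add: endo_inj_surj)
  qed
  ultimately have "?N = carrier G"
    using max[OF subgroup_conjugation_invariant[OF M(1)]] \<open>g \<notin> M\<close> by blast
  then show ?thesis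
    using M(1) unfolding normal_inv_iff by blast
qed

lemma (in group) p_group_proper_subgroup_in_proper_normal:
  assumes p: "Factorial_Ring.prime (p::nat)" and G: "order G = p ^ n"
    and H: "subgroup H G" "H \<noteq> carrier G"
  obtains M where "M \<lhd> G" "H \<subseteq> M" "M \<noteq> carrier G"
proof -
  let ?X = "{K. subgroup K G \<and> K \<noteq> carrier G}"
  have "order G > 0"
    using G p prime_gt_0_nat by simp
  then have "finite (carrier G)"
    by (simp add: order_gt_0_iff_finite)
  then have "finite ?X"
    by (rule finite_subset[rotated, OF finite_Pow_iff[THEN iffD2]]) (auto dest: subgroup.subset)
  then obtain M where M: "M \<in> ?X" "H \<subseteq> M" "\<forall>K\<in>?X. M \<subseteq> K \<longrightarrow> M = K"
    using finite_has_maximal2[of ?X H] H by auto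
  then have "M \<lhd> G"
    by (intro p_group_maximal_subgroup_normal[OF p G]) auto
  with M show thesis
    using that by blast
qed

section \<open>Transitive groups of prime power degree\<close>

text \<open>The stabiliser of \<open>y\<close> in \<open>S\<close> is a \<open>p\<close>-subgroup of its stabiliser in \<open>G\<close>, which has order
  \<open>p\<^sup>a m / p\<^sup>k\<close>. Hence its order is at most \<open>p\<^sup>a / p\<^sup>k\<close>, and the orbit of \<open>y\<close> under \<open>S\<close> has at
  least \<open>p\<^sup>k\<close> elements.\<close>

lemma (in transitive_action) Sylow_subgroup_transitive:
  assumes p: "Factorial_Ring.prime (p::nat)" and G: "order G = p ^ a * m" "\<not> p dvd m"
    and E: "finite E" "card E = p ^ k"
    and S: "subgroup S G" "card S = p ^ a" and y: "y \<in> E"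
  shows "orbit (G\<lparr>carrier := S\<rparr>) \<phi> y = E"
proof -
  interpret G: group G
    using group_hom group_hom.axioms(1) by auto
  interpret S: group_action "G\<lparr>carrier := S\<rparr>" E \<phi>
    by (rule induced_action[OF S(1)])
  let ?O = "orbit (G\<lparr>carrier := S\<rparr>) \<phi> y"
  let ?T = "stabilizer (G\<lparr>carrier := S\<rparr>) \<phi> y"
  let ?U = "stabilizer G \<phi> y"
  have SG: "S \<subseteq> carrier G"
    by (rule subgroup.subset[OF S(1)])
  have OT: "card ?O * card ?T = p ^ a"
    using S.orbit_stabilizer_theorem[OF y] S(2) by (simp add: order_def)
  have "orbit G \<phi> y = E"
    using unique_orbit[OF y] element_image y by (auto simp: orbit_def)
  then have EU: "p ^ k * card ?U = p ^ a * m"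
    using orbit_stabilizer_theorem[OF y] G E by simp
  have "subgroup ?T G"
    using G.incl_subgroup[OF S(1) S.stabilizer_subgroup[OF y]] .
  moreover have "?T \<subseteq> ?U"
    using SG by (auto simp: stabilizer_def)
  ultimately have "subgroup ?T (G\<lparr>carrier := ?U\<rparr>)"
    using G.subgroup_incl stabilizer_subgroup[OF y] by blast
  moreover have "group (G\<lparr>carrier := ?U\<rparr>)"
    using G.subgroup_imp_group stabilizer_subgroup[OF y] by blast
  ultimately have "card (rcosets\<^bsub>G\<lparr>carrier := ?U\<rparr>\<^esub> ?T) * card ?T = card ?U"
    using group.lagrange[of "G\<lparr>carrier := ?U\<rparr>" ?T] by (simp add: order_def)
  then have "card ?T dvd card ?U"
    by (metis dvd_triv_right)
  then have "p ^ k * card ?T dvd p ^ a * m"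
    unfolding EU[symmetric] by (rule mult_dvd_mono[OF dvd_refl])
  moreover have "coprime (p ^ k * card ?T) m"
  proof -
    have "coprime p m"
      using p G(2) by (simp add: prime_imp_coprime)
    moreover have "card ?T dvd p ^ a"
      using OT by (metis dvd_triv_right)
    ultimately show ?thesis
      by (auto intro: coprime_divisors[of _ "p ^ a" m m])
  qed
  ultimately have "p ^ k * card ?T dvd card ?O * card ?T"
    using OT by (simp add: coprime_dvd_mult_left_iff)
  moreover have pos: "card ?O * card ?T > 0"
    using OT prime_gt_0_nat[OF p] by simp
  ultimately have "card E \<le> card ?O"
    using E(2) by (auto dest: dvd_imp_le)
  moreover have "?O \<subseteq> E"
    using S.element_image y by (auto simp: orbit_def)
  ultimately show ?thesis
    using E(1) card_seteq by blast
qed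

text \<open>This is the group-theoretic core. The map \<open>t\<close> stands for \<open>x \<mapsto> L\<^sub>x\<close>; equivariance and
  transitivity together say that its image is one conjugacy class.\<close>

theorem (in transitive_action) prime_power_degree_equivariant_imp_cyclic:
  assumes p: "Factorial_Ring.prime (p::nat)" and fin: "finite (carrier G)"
    and E: "finite E" "card E = p ^ k"
    and t: "\<And>x. x \<in> E \<Longrightarrow> t x \<in> carrier G"
    and equiv: "\<And>g x. g \<in> carrier G \<Longrightarrow> x \<in> E \<Longrightarrow> t (\<phi> g x) = g \<otimes> t x \<otimes> inv g"
    and gen: "carrier G = generate G (t ` E)"
    and x: "x \<in> E" "card (generate G {t x}) = p ^ n"
  shows "carrier G = generate G {t x}"
proof -
  interpret G: group G
    using group_hom group_hom.axioms(1) by auto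
  have gen_le: "K = carrier G" if "subgroup K G" "t ` E \<subseteq> K" for K
    using G.generate_subgroup_incl[OF that(2,1)] gen subgroup.subset[OF that(1)] by blast
  define P where "P = generate G {t x}"
  have P: "subgroup P G" "card P = p ^ n"
    using G.generate_is_subgroup t x by (auto simp: P_def)
  have "order G > 0"
    using fin G.order_gt_0_iff_finite by blast
  then obtain a m where G: "order G = p ^ a * m" "\<not> p dvd m"
    using multiplicity_decompose'[of "order G" p] p prime_gt_1_nat[OF p]
    by (metis neq0_conv not_prime_unit)
  obtain S where S: "subgroup S G" "card S = p ^ a"
    using sylow_thm[OF p G.is_group G(1) fin] by blast
  have "card (rcosets S) * p ^ a = p ^ a * m"
    using G.lagrange[OF S(1)] G S by simp
  then have index: "card (rcosets S) = m"
    using prime_gt_0_nat[OF p] by simp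
  \<comment> \<open>Since \<open>p\<close> does not divide the index, \<open>P\<close> fixes a coset of \<open>S\<close>, so \<open>S\<close> meets the class of \<open>t x\<close>.\<close>
  have "{C \<in> rcosets S. \<forall>h\<in>P. C #> h = C} \<noteq> {}"
  proof
    assume "{C \<in> rcosets S. \<forall>h\<in>P. C #> h = C} = {}"
    then show False
      using G.p_subgroup_card_fixed_cosets[OF p fin S(1) P] index G(2)
      by (simp only: card.empty diff_zero)
  qed
  then obtain g where g: "g \<in> carrier G" "\<forall>h\<in>P. (S #> g) #> h = S #> g"
    by (auto simp: RCOSETS_def)
  define y where "y = \<phi> g x"
  have y: "y \<in> E"
    using g x element_image y_def by blast
  have "t x \<in> P"
    by (simp add: P_def generate.incl)
  then have ty: "t y \<in> S"
    using G.fixed_coset_iff[OF S(1) subgroup.subset[OF P(1)] g(1)] g x equiv by (simp add: y_def)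
  \<comment> \<open>As \<open>S\<close> is transitive, conjugating \<open>t y\<close> within \<open>S\<close> reaches the whole class.\<close>
  have "t ` E \<subseteq> S"
  proof
    fix s assume "s \<in> t ` E"
    then obtain z where z: "z \<in> E" "s = t z"
      by blast
    then obtain h where "h \<in> S" "z = \<phi> h y"
      using Sylow_subgroup_transitive[OF p G E S y] by (auto simp: orbit_def)
    then show "s \<in> S"
      using z ty y equiv subgroup.mem_carrier[OF S(1)] S(1)
      by (simp add: subgroup.m_closed subgroup.m_inv_closed)
  qed
  then have "S = carrier G"
    using gen_le S(1) by blast
  then have order: "order G = p ^ a"
    using S(2) by (simp add: order_def)
  show ?thesis
  proof (rule ccontr)
    assume "carrier G \<noteq> generate G {t x}"
    then have "P \<noteq> carrier G"
      by (simp add: P_def)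
    then obtain M where M: "M \<lhd> G" "P \<subseteq> M" "M \<noteq> carrier G"
      using G.p_group_proper_subgroup_in_proper_normal[OF p order P(1)] by blast
    have "t ` E \<subseteq> M"
    proof
      fix s assume "s \<in> t ` E"
      then obtain z where z: "z \<in> E" "s = t z"
        by blast
      then obtain h where "h \<in> carrier G" "z = \<phi> h x"
        using unique_orbit x by metis
      then show "s \<in> M"
        using z x equiv M \<open>t x \<in> P\<close> unfolding G.normal_inv_iff by auto
    qed
    then show False
      using gen_le M normal_imp_subgroup by blast
  qed
qed

section \<open>Connected racks of prime power size\<close>

context rack
begin

abbreviation "L \<equiv> left_translation Q (\<star>)"

lemma generate_left_translations_subgroup:
  "subgroup (generate (BijGroup Q) (L ` Q)) (BijGroup Q)"
  by (rule group.generate_is_subgroup[OF group_BijGroup]) (use left_translation_Bij in auto)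

lemma left_mult_group_automorphism:
  assumes "g \<in> generate (BijGroup Q) (L ` Q)" "x \<in> Q" "y \<in> Q"
  shows "g (x \<star> y) = g x \<star> g y"
proof -
  have Bij: "h \<in> Bij Q" if "h \<in> generate (BijGroup Q) (L ` Q)" for h
    using subgroup.mem_carrier[OF generate_left_translations_subgroup that]
    by (simp add: BijGroup_def)
  have "\<forall>x\<in>Q. \<forall>y\<in>Q. g (x \<star> y) = g x \<star> g y"
    using assms(1)
  proof (induction rule: generate.induct)
    case one
    then show ?case
      by (simp add: BijGroup_def mul_closed)
  next
    case (incl h)
    then show ?case
      by (auto simp: left_translation_def mul_closed left_distrib[symmetric])
  next
    case (inv h)
    then obtain a where a: "a \<in> Q" "h = L a"
      by blast
    have h: "h \<in> Bij Q"
      using left_translation_Bij a by (simp add: BijGroup_def)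
    have "inv_into Q h (x \<star> y) = inv_into Q h x \<star> inv_into Q h y" if "x \<in> Q" "y \<in> Q" for x y
      by (rule Bij_inv_into_lemma[where g = "(\<star>)" and S = Q])
         (use that a h in \<open>auto simp: left_translation_def mul_closed left_distrib[symmetric]\<close>)
    then show ?case
      using h by (simp add: inv_BijGroup mul_closed)
  next
    case (eng h1 h2)
    then show ?case
      using Bij[OF eng(1)] Bij[OF eng(2)] Bij_imp_funcset[of h2 Q]
      by (auto simp: BijGroup_def compose_def mul_closed Pi_iff)
  qed
  then show ?thesis
    using assms by blast
qed

lemma left_translation_equivariant:
  assumes g: "g \<in> generate (BijGroup Q) (L ` Q)" and x: "x \<in> Q"
  shows "L (g x) = g \<otimes>\<^bsub>BijGroup Q\<^esub> L x \<otimes>\<^bsub>BijGroup Q\<^esub> inv\<^bsub>BijGroup Q\<^esub> g"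
proof -
  interpret B: group "BijGroup Q"
    by (rule group_BijGroup)
  have gB: "g \<in> carrier (BijGroup Q)"
    using subgroup.mem_carrier[OF generate_left_translations_subgroup g] .
  then have g': "g \<in> Bij Q"
    by (simp add: BijGroup_def)
  then have gx: "g y \<in> Q" if "y \<in> Q" for y
    using Bij_imp_funcset that by blast
  have Lx: "L x \<in> carrier (BijGroup Q)" and Lgx: "L (g x) \<in> carrier (BijGroup Q)"
    using left_translation_Bij gx x by auto
  have "compose Q (L (g x)) g = compose Q g (L x)"
    unfolding compose_def
    by (rule restrict_ext)
       (use left_mult_group_automorphism[OF g x] x gx mul_closed in \<open>auto simp: left_translation_def\<close>)
  then have "L (g x) \<otimes>\<^bsub>BijGroup Q\<^esub> g = g \<otimes>\<^bsub>BijGroup Q\<^esub> L x"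
    using g' Lx Lgx by (simp add: BijGroup_def)
  then show ?thesis
    using gB Lx Lgx B.inv_solve_right by simp
qed

text \<open>The hypothesis on \<open>x\<close> says that the order of \<open>L\<^sub>x\<close> is a power of \<open>p\<close>.\<close>

theorem connected_prime_power_left_mult_group_cyclic:
  assumes conn: "connected_lq Q (\<star>)" and p: "Factorial_Ring.prime (p::nat)" and Q: "finite Q" "card Q = p ^ k"
    and x: "x \<in> Q" "card (generate (BijGroup Q) {L x}) = p ^ n"
  shows "generate (BijGroup Q) (L ` Q) = generate (BijGroup Q) {L x}"
proof -
  let ?G = "left_mult_group Q (\<star>)"
  note sub = generate_left_translations_subgroup
  interpret B: group "BijGroup Q"
    by (rule group_BijGroup)
  interpret transitive_action ?G Q "\<lambda>g. g"
    using conn by (simp add: connected_lq_def)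
  have carr: "carrier ?G = generate (BijGroup Q) (L ` Q)"
    by (simp add: left_mult_group_def)
  have gen: "generate ?G K = generate (BijGroup Q) K" if "K \<subseteq> L ` Q" for K
    unfolding left_mult_group_def
    by (rule B.generate_consistent[OF _ sub]) (use that in \<open>auto intro: generate.incl\<close>)
  have "Bij Q \<subseteq> Q \<rightarrow>\<^sub>E Q"
    by (auto simp: PiE_def Bij_imp_extensional dest: Bij_imp_funcset)
  then have "finite (Bij Q)"
    using finite_PiE[OF Q(1), of "\<lambda>_. Q"] Q(1) finite_subset by blast
  then have fin: "finite (carrier ?G)"
    using subgroup.subset[OF sub] finite_subset by (auto simp: carr BijGroup_def)
  have "carrier ?G = generate ?G {L x}"
  proof (rule prime_power_degree_equivariant_imp_cyclic[OF p fin Q, where t = L])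
    show "L y \<in> carrier ?G" if "y \<in> Q" for y
      using that by (auto simp: carr intro: generate.incl)
    show "L (g y) = g \<otimes>\<^bsub>?G\<^esub> L y \<otimes>\<^bsub>?G\<^esub> inv\<^bsub>?G\<^esub> g" if "g \<in> carrier ?G" "y \<in> Q" for g y
    proof -
      have "inv\<^bsub>?G\<^esub> g = inv\<^bsub>BijGroup Q\<^esub> g"
        unfolding left_mult_group_def
        by (rule B.m_inv_consistent[OF sub]) (use that carr in simp)
      then show ?thesis
        using left_translation_equivariant that carr by (simp add: left_mult_group_def)
    qed
    show "carrier ?G = generate ?G (L ` Q)"
      by (simp add: gen carr)
    show "x \<in> Q" "card (generate ?G {L x}) = p ^ n"
      using x by (simp_all add: gen)
  qed
  then show ?thesis
    using x by (simp add: gen carr)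
qed

lemma involutory_generate_left_translation:
  assumes inv: "involutory Q (\<star>)" and x: "x \<in> Q"
  shows "generate (BijGroup Q) {L x} = {\<one>\<^bsub>BijGroup Q\<^esub>, L x}"
proof -
  interpret B: group "BijGroup Q"
    by (rule group_BijGroup)
  have Lx: "L x \<in> carrier (BijGroup Q)"
    by (rule left_translation_Bij[OF x])
  have "compose Q (L x) (L x) = (\<lambda>y\<in>Q. y)"
    unfolding compose_def
    by (rule restrict_ext) (use inv x mul_closed in \<open>auto simp: involutory_def left_translation_def\<close>)
  then have sq: "L x \<otimes>\<^bsub>BijGroup Q\<^esub> L x = \<one>\<^bsub>BijGroup Q\<^esub>"
    using Lx by (simp add: BijGroup_def)
  then have "inv\<^bsub>BijGroup Q\<^esub> L x = L x"
    using Lx B.inv_equality by blast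
  then have "subgroup {\<one>\<^bsub>BijGroup Q\<^esub>, L x} (BijGroup Q)"
    using Lx sq by (intro B.subgroupI) auto
  then have "generate (BijGroup Q) {L x} \<subseteq> {\<one>\<^bsub>BijGroup Q\<^esub>, L x}"
    by (intro B.generate_subgroup_incl) auto
  then show ?thesis
    by (auto intro: generate.one generate.incl)
qed

text \<open>The two-element case does occur: the set of two elements in which every translation is the
  transposition is a connected involutory rack. This is why the bound for racks is weaker than the
  one for quandles.\<close>

lemma connected_involutory_power_of_two:
  assumes conn: "connected_lq Q (\<star>)" and inv: "involutory Q (\<star>)"
    and card: "card Q = 2 ^ k" and x: "x \<in> Q"
  shows "Q = {x, x \<star> x}"
proof -
  have gen: "generate (BijGroup Q) {L x} = {\<one>\<^bsub>BijGroup Q\<^esub>, L x}"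
    by (rule involutory_generate_left_translation[OF inv x])
  obtain n where n: "card (generate (BijGroup Q) {L x}) = 2 ^ n"
  proof (cases "L x = \<one>\<^bsub>BijGroup Q\<^esub>")
    case True
    then show thesis
      by (intro that[of 0]) (subst gen, simp add: True)
  next
    case False
    then show thesis
      by (intro that[of 1]) (subst gen, simp add: eq_commute)
  qed
  have "finite Q"
    using card by (metis card.infinite power_not_zero zero_neq_numeral)
  have all: "generate (BijGroup Q) (L ` Q) = {\<one>\<^bsub>BijGroup Q\<^esub>, L x}"
    using connected_prime_power_left_mult_group_cyclic[OF conn two_is_prime_nat \<open>finite Q\<close> card x n]
      gen by simp
  have "y \<in> {x, x \<star> x}" if y: "y \<in> Q" for y
  proof -
    obtain g where "g \<in> {\<one>\<^bsub>BijGroup Q\<^esub>, L x}" "g x = y"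
      using conn x y unfolding connected_lq_iff all by blast
    then show ?thesis
      using x by (auto simp: BijGroup_def left_translation_def)
  qed
  then show ?thesis
    using x mul_closed by blast
qed

end

theorem theorem8p1:
  shows "(\<forall>k::nat. k \<ge> 1 \<longrightarrow>
            \<not> (\<exists>(Q :: 'a set) mul ldiv.
                 quandle Q mul ldiv \<and> involutory Q mul \<and> connected_lq Q mul \<and> card Q = 2 ^ k))
       \<and> (\<forall>k::nat. k > 1 \<longrightarrow>
            \<not> (\<exists>(Q :: 'a set) mul ldiv.
                 rack Q mul ldiv \<and> involutory Q mul \<and> connected_lq Q mul \<and> card Q = 2 ^ k))"
proof (intro conjI allI impI notI; elim exE conjE)
  fix k :: nat and Q :: "'a set" and mul ldiv
  assume k: "1 \<le> k" and "quandle Q mul ldiv" and Q: "involutory Q mul" "connected_lq Q mul" "card Q = 2 ^ k"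
  then interpret quandle Q mul ldiv
    by simp
  obtain x where x: "x \<in> Q"
    using nonempty by blast
  then have "Q = {x}"
    using connected_involutory_power_of_two[OF Q(2,1,3) x] idem by simp
  then have "(2::nat) ^ k = 1"
    using Q(3) by simp
  then show False
    using k by simp
next
  fix k :: nat and Q :: "'a set" and mul ldiv
  assume k: "1 < k" and "rack Q mul ldiv" and Q: "involutory Q mul" "connected_lq Q mul" "card Q = 2 ^ k"
  then interpret rack Q mul ldiv
    by simp
  obtain x where x: "x \<in> Q"
    using nonempty by blast
  then have "card Q \<le> 2"
    using connected_involutory_power_of_two[OF Q(2,1,3) x] card_insert_le_m1[of 2 "{mul x x}" x]
    by simp
  moreover have "(2::nat) ^ 1 < 2 ^ k"
    using k by (intro power_strict_increasing) auto
  ultimately show False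
    using Q(3) by simp
qed

end
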